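(* There exists an instance of the prize-collecting Steiner tree problem for which the linear program (PCST-LP) has an extreme point $(x,z)$ such that $x_e>0$ for every edge $e$, and all variables (all $x_e$ and all $z_v$) have value at most $1/3$.
   Context: An instance of the (rooted) prize-collecting Steiner tree problem (PCST) consists of a finite undirected graph $G=(V,E)$, edge costs $c_e\ge 0$, a set of terminals $R\subseteq V$ with penalties $\pi_v\ge 0$, and a root node $r\in R$; each terminal $v\in R\setminus\{r\}$ is modeled by the terminal pair $(v,r)$. For $S\subseteq V$, $\delta(S)$ is the set of edges with exactly one endpoint in $S$, and $x(\delta(S))=\sum_{e\in\delta(S)}x_e$. (PCST-LP) is the linear program with variables $x\in\mathbb{R}^E$ and $z\in\mathbb{R}^{R\setminus\{r\}}$: $$\min\ \sum_{e\in E}c_ex_e+\sum_{v\in R\setminus\{r\}}\pi_vz_v\quad\text{s.t.}\quad x(\delta(S))+z_v\ge1\ \ \text{for all } v\in R\setminus\{r\} \text{ and all } S\subseteq V \text{ containing exactly one of } v,r,\qquad x\ge0,\ z\ge0.$$ An extreme point (vertex, basic feasible solution) of (PCST-LP) means an extreme point of its feasible region, which is a polyhedron depending only on $G$, $R$ and $r$. *)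

theory Defs
  imports "HOL-Analysis.Polytope" "HOL-Analysis.Finite_Function_Topology"
begin

locale pcst_instance =
  fixes V :: "'v set"
    and E :: "'v set set"
    and c :: "'v set \<Rightarrow> real"
    and R :: "'v set"
    and \<pi> :: "'v \<Rightarrow> real"
    and r :: 'v
  assumes finite_V: "finite V"
    and edges: "\<And>e. e \<in> E \<Longrightarrow> e \<subseteq> V \<and> card e = 2"
    and cost_nonneg: "\<And>e. e \<in> E \<Longrightarrow> c e \<ge> 0"
    and terminals: "R \<subseteq> V"
    and penalty_nonneg: "\<And>v. v \<in> R \<Longrightarrow> \<pi> v \<ge> 0"
    and root: "r \<in> R"

definition cut :: "'v set set \<Rightarrow> 'v set \<Rightarrow> 'v set set" where
  "cut E S = {e \<in> E. card (e \<inter> S) = 1}"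

text \<open>A vector indexed by a finite set \<open>I\<close> is represented by a finitely supported function
  whose support is contained in \<open>I\<close>. The two \<open>keys\<close> conditions thus say
  that \<open>x\<close> is indexed by \<open>E\<close> and \<open>z\<close> by \<open>R - {r}\<close>; they identify the set below with a
  polyhedron in a product of two coordinate spaces, so that the library notion
  of extreme point in a real vector space applies to it.\<close>

definition pcst_lp_feasible ::
    "'v set \<Rightarrow> 'v set set \<Rightarrow> 'v set \<Rightarrow> 'v \<Rightarrow> (('v set \<Rightarrow>\<^sub>0 real) \<times> ('v \<Rightarrow>\<^sub>0 real)) set" where
  "pcst_lp_feasible V E R r =
    {(x, z).
       Poly_Mapping.keys x \<subseteq> E \<and> Poly_Mapping.keys z \<subseteq> R - {r} \<and>
       (\<forall>v \<in> R - {r}. \<forall>S. S \<subseteq> V \<and> (v \<in> S) \<noteq> (r \<in> S) \<longrightarrow>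
          (\<Sum>e \<in> cut E S. Poly_Mapping.lookup x e) + Poly_Mapping.lookup z v \<ge> 1) \<and>
       (\<forall>e \<in> E. Poly_Mapping.lookup x e \<ge> 0) \<and>
       (\<forall>v \<in> R - {r}. Poly_Mapping.lookup z v \<ge> 0)}"

end

theory Submission
  imports Defs
begin

text \<open>The extreme point lives on six edge-disjoint wires from vertex 0 to the root 21, arranged in
  a row. For \<open>k < 5\<close> the vertices \<open>4k+1, 4k+3\<close> (on wire \<open>k\<close>) and
  \<open>4k+2, 4k+4\<close> (on wire \<open>k+1\<close>) form a block, and \<open>4k+1, 4k+2, 4k+4, 4k+3\<close> is a 4-cycle linking
  the two wires. Give every wire and every cycle the weight 1/6; the edges lying on both get 1/3.

  Feasibility: a cut separating 0 from the root meets all six wires, so its value is at least 1. A cut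
  with 0 and the root on the same side, but some vertex of a block on the other, either meets both wires
  of the block twice, or meets one of them twice and also the 4-cycle twice, so its value is at least 2/3.

  Extremality: the tight cuts of a block (its vertices, its two halves on a wire, and the whole block),
  together with the equality of the total weights entering and leaving it (compare the cuts of value 1
  around \<open>{..4k}\<close> and \<open>{..4k+4}\<close>), force the four edges at the boundary of the block to be
  equal, and all edges of the block to be determined by them.
  Hence all six wires carry the same weight, which the cut around vertex 0 forces to be 1/6.\<close>

section \<open>Sums over cuts as sums over edge lists\<close>

definition edges_of :: "('v \<times> 'v) list \<Rightarrow> 'v set set" where
  "edges_of ps = (\<lambda>(i, j). {i, j}) ` set ps"

lemma edges_of_append: "edges_of (ps @ qs) = edges_of ps \<union> edges_of qs"
  by (simp add: edges_of_def image_Un)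

lemma finite_edges_of [simp]: "finite (edges_of ps)"
  by (simp add: edges_of_def)

lemma edges_ofI: "(i, j) \<in> set ps \<Longrightarrow> {i, j} \<in> edges_of ps"
  unfolding edges_of_def by force

text \<open>Ordering each pair by \<open>i < j\<close> makes the passage from pairs to unordered
  edges injective. A cut sum thereby becomes a list sum, which simplification evaluates on a
  concrete network.\<close>

lemma sum_cut_edges_of:
  fixes f :: "'v::linorder set \<Rightarrow> real"
  assumes "distinct ps" and less: "\<forall>(i, j) \<in> set ps. i < j"
  shows "(\<Sum>e \<in> cut (edges_of ps) S. f e) =
         (\<Sum>(i, j) \<leftarrow> ps. if (i \<in> S) = (j \<in> S) then 0 else f {i, j})"
proof -
  have inj: "inj_on (\<lambda>(i, j). {i, j}) (set ps)"
    using less by (auto simp: inj_on_def doubleton_eq_iff) (metis (no_types, lifting) case_prodD less_asym)+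
  have card: "card ({i, j} \<inter> S) = 1 \<longleftrightarrow> (i \<in> S) \<noteq> (j \<in> S)" if "i \<noteq> j" for i j
    using that by (cases "i \<in> S"; cases "j \<in> S") (auto simp: Int_insert_left)
  have "(\<Sum>e \<in> cut (edges_of ps) S. f e) =
        (\<Sum>e \<in> edges_of ps. if card (e \<inter> S) = 1 then f e else 0)"
    unfolding cut_def by (rule sum.inter_filter) simp
  also have "\<dots> = (\<Sum>(i, j) \<in> set ps. if card ({i, j} \<inter> S) = 1 then f {i, j} else 0)"
    unfolding edges_of_def by (subst sum.reindex[OF inj]) (simp add: case_prod_unfold)
  also have "\<dots> = (\<Sum>(i, j) \<in> set ps. if (i \<in> S) = (j \<in> S) then 0 else f {i, j})"
    using less card by (intro sum.cong) (fastforce dest: less_imp_neq)+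
  also have "\<dots> = (\<Sum>(i, j) \<leftarrow> ps. if (i \<in> S) = (j \<in> S) then 0 else f {i, j})"
    using assms(1) by (simp add: sum_list_distinct_conv_sum_set)
  finally show ?thesis .
qed

section \<open>Extreme points from tight constraints\<close>

lemma lookup_scaleR: "Poly_Mapping.lookup (c *\<^sub>R p) i = c *\<^sub>R Poly_Mapping.lookup p i"
  by (simp add: scaleR_poly_mapping_def)

lemma convex_combination_tight:
  fixes u p q t :: real
  assumes "0 < u" "u < 1" "p \<ge> t" "q \<ge> t" "(1 - u) * p + u * q = t"
  shows "p = t" "q = t"
proof -
  have *: "(1 - u) * (p - t) + u * (q - t) = 0"
    using assms by (simp add: algebra_simps)
  moreover have "(1 - u) * (p - t) \<ge> 0" "u * (q - t) \<ge> 0"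
    using assms by simp_all
  ultimately have "(1 - u) * (p - t) = 0" "u * (q - t) = 0" by linarith+
  then show "p = t" "q = t" using assms by simp_all
qed

lemma pcst_lp_feasibleD:
  assumes "(x, z) \<in> pcst_lp_feasible V E R r"
  shows "Poly_Mapping.keys x \<subseteq> E" "Poly_Mapping.keys z \<subseteq> R - {r}"
    and "\<And>v S. v \<in> R - {r} \<Longrightarrow> S \<subseteq> V \<Longrightarrow> (v \<in> S) \<noteq> (r \<in> S) \<Longrightarrow>
      (\<Sum>e \<in> cut E S. Poly_Mapping.lookup x e) + Poly_Mapping.lookup z v \<ge> 1"
    and "\<And>v. v \<in> R - {r} \<Longrightarrow> Poly_Mapping.lookup z v \<ge> 0"
  using assms unfolding pcst_lp_feasible_def by simp_all

text \<open>A constraint tight at an interior point of a segment of feasible points is tight at both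
  ends, so uniqueness makes the ends coincide. The tight constraints considered are cuts and zeros
  of \<open>z\<close>; the point used below is positive on all edges.\<close>

lemma extreme_point_pcst_lpI:
  assumes feas: "(x, z) \<in> pcst_lp_feasible V E R r"
    and uniq: "\<And>x' z'. (x', z') \<in> pcst_lp_feasible V E R r \<Longrightarrow>
      (\<And>v S. v \<in> R - {r} \<Longrightarrow> S \<subseteq> V \<Longrightarrow> (v \<in> S) \<noteq> (r \<in> S) \<Longrightarrow>
         (\<Sum>e \<in> cut E S. Poly_Mapping.lookup x e) + Poly_Mapping.lookup z v = 1 \<Longrightarrow>
         (\<Sum>e \<in> cut E S. Poly_Mapping.lookup x' e) + Poly_Mapping.lookup z' v = 1) \<Longrightarrow>
      (\<And>v. v \<in> R - {r} \<Longrightarrow> Poly_Mapping.lookup z v = 0 \<Longrightarrow> Poly_Mapping.lookup z' v = 0) \<Longrightarrow>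
      x' = x \<and> z' = z"
  shows "(x, z) extreme_point_of pcst_lp_feasible V E R r"
  unfolding extreme_point_of_def
proof (intro conjI ballI notI)
  fix a b
  assume a: "a \<in> pcst_lp_feasible V E R r" and b: "b \<in> pcst_lp_feasible V E R r"
    and "(x, z) \<in> open_segment a b"
  then obtain u where u: "a \<noteq> b" "0 < u" "u < 1" "(x, z) = (1 - u) *\<^sub>R a + u *\<^sub>R b"
    by (auto simp: in_segment)
  obtain xa za xb zb where ab: "a = (xa, za)" "b = (xb, zb)"
    by (metis surj_pair)
  have x: "Poly_Mapping.lookup x e =
      (1 - u) * Poly_Mapping.lookup xa e + u * Poly_Mapping.lookup xb e" for e
    using u(4) ab by (simp add: lookup_add lookup_scaleR)
  have z: "Poly_Mapping.lookup z v =
      (1 - u) * Poly_Mapping.lookup za v + u * Poly_Mapping.lookup zb v" for v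
    using u(4) ab by (simp add: lookup_add lookup_scaleR)
  have tight: "(\<Sum>e \<in> cut E S. Poly_Mapping.lookup xa e) + Poly_Mapping.lookup za v = 1"
              "(\<Sum>e \<in> cut E S. Poly_Mapping.lookup xb e) + Poly_Mapping.lookup zb v = 1"
    if v: "v \<in> R - {r}" "S \<subseteq> V" "(v \<in> S) \<noteq> (r \<in> S)"
      and eq: "(\<Sum>e \<in> cut E S. Poly_Mapping.lookup x e) + Poly_Mapping.lookup z v = 1" for v S
  proof -
    let ?p = "(\<Sum>e \<in> cut E S. Poly_Mapping.lookup xa e) + Poly_Mapping.lookup za v"
    let ?q = "(\<Sum>e \<in> cut E S. Poly_Mapping.lookup xb e) + Poly_Mapping.lookup zb v"
    have "?p \<ge> 1" "?q \<ge> 1"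
      using pcst_lp_feasibleD(3)[OF _ v] a b ab by simp_all
    moreover have "(\<Sum>e \<in> cut E S. Poly_Mapping.lookup x e) =
        (1 - u) * (\<Sum>e \<in> cut E S. Poly_Mapping.lookup xa e) +
        u * (\<Sum>e \<in> cut E S. Poly_Mapping.lookup xb e)"
      by (simp add: x sum.distrib sum_distrib_left)
    then have "(1 - u) * ?p + u * ?q = 1"
      using eq z[of v] by (simp add: algebra_simps)
    ultimately show "?p = 1" "?q = 1"
      using convex_combination_tight[OF u(2,3)] by blast+
  qed
  have zero: "Poly_Mapping.lookup za v = 0" "Poly_Mapping.lookup zb v = 0"
    if v: "v \<in> R - {r}" and eq: "Poly_Mapping.lookup z v = 0" for v
  proof -
    have "Poly_Mapping.lookup za v \<ge> 0" "Poly_Mapping.lookup zb v \<ge> 0"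
      using pcst_lp_feasibleD(4)[OF _ v] a b ab by simp_all
    then show "Poly_Mapping.lookup za v = 0" "Poly_Mapping.lookup zb v = 0"
      using convex_combination_tight[OF u(2,3)] eq z by metis+
  qed
  have "xa = x \<and> za = z" "xb = x \<and> zb = z"
    using uniq a b ab tight zero by auto
  then show False using u(1) ab by simp
qed (rule feas)

section \<open>The network of wires and cycles\<close>

definition heavy :: "(nat \<times> nat) list" where
  "heavy = concat (map (\<lambda>k. [(4*k+1, 4*k+3), (4*k+2, 4*k+4)]) [0..<5])"

text \<open>The pair \<open>(4*k, 4*k+1)\<close> starts wire 0 when \<open>k = 0\<close>, and
  otherwise joins block \<open>k - 1\<close> to block \<open>k\<close> along wire \<open>k\<close>;
  \<open>(20, 21)\<close> ends the last wire.\<close>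

definition light :: "(nat \<times> nat) list" where
  "light = concat (map (\<lambda>k. [(0, 4*k+2), (4*k+1, 4*k+2), (4*k+3, 4*k+4), (4*k+3, 21),
    (4*k, 4*k+1)]) [0..<5]) @ [(20, 21)]"

lemma upt_0_5: "[0..<5] = [0, 1, 2, 3, 4]"
  by (simp add: upt_rec)

lemmas edge_list_defs = heavy_def[unfolded upt_0_5] light_def[unfolded upt_0_5]

lemma less_5E:
  assumes "(k::nat) < 5"
  obtains "k = 0" | "k = 1" | "k = 2" | "k = 3" | "k = 4"
  using assms by linarith

lemma heavy_light:
  shows "distinct (heavy @ light)" "\<forall>(i, j) \<in> set (heavy @ light). i < j \<and> j \<le> 21"
  by (simp_all add: edge_list_defs)

lemma heavy_light_disjoint: "edges_of heavy \<inter> edges_of light = {}"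
  by (simp add: edge_list_defs edges_of_def doubleton_eq_iff)

definition net :: "nat set set" where
  "net = edges_of (heavy @ light)"

lemma sum_cut_net:
  "(\<Sum>e \<in> cut net S. f e) =
   (\<Sum>(i, j) \<leftarrow> heavy @ light. if (i \<in> S) = (j \<in> S) then 0 else f {i, j} :: real)"
  unfolding net_def using heavy_light by (intro sum_cut_edges_of) auto

section \<open>Lower bounds on cuts by counting crossings\<close>

fun path_length :: "('a \<Rightarrow> 'a \<Rightarrow> real) \<Rightarrow> 'a list \<Rightarrow> real" where
  "path_length d (i # j # p) = d i j + path_length d (j # p)"
| "path_length d p = 0"

lemma path_length_ge:
  assumes tri: "\<And>i j k. d i k \<le> d i j + d j k" and refl: "\<And>i. d i i = 0"
  shows "p \<noteq> [] \<Longrightarrow> d (hd p) (last p) \<le> path_length d p"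
proof (induction p rule: induct_list012)
  case (3 i j p)
  then have "d j (last (j # p)) \<le> path_length d (j # p)" by simp
  with tri[of i "last (j # p)" j] have "d i (last (j # p)) \<le> d i j + path_length d (j # p)"
    by linarith
  then show ?case by simp
qed (auto simp: refl)

text \<open>The first inner pair of vertices lies in block \<open>j - 1\<close>, the second in block
  \<open>j\<close>; the outer wires 0 and 5 meet only one block.\<close>

definition wire :: "nat \<Rightarrow> nat list" where
  "wire j = 0 # (if j = 0 then [] else [4*j - 2, 4*j]) @
     (if j = 5 then [] else [4*j + 1, 4*j + 3]) @ [21]"

definition cycle :: "nat \<Rightarrow> nat list" where
  "cycle k = [4*k+1, 4*k+3, 4*k+4, 4*k+2, 4*k+1]"

text \<open>With this \<open>d\<close>, \<open>path_length\<close> counts how often a path crosses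
  the cut. A light edge lies on exactly one wire or cycle and a heavy edge on one of each, which
  matches the weights 1/6 and 1/3.\<close>

lemma six_cut_net_eq_wires:
  fixes S :: "nat set"
  defines "d \<equiv> \<lambda>i j. of_bool ((i \<in> S) \<noteq> (j \<in> S)) :: real"
  assumes f: "\<And>e. e \<in> edges_of heavy \<Longrightarrow> f e = 1/3" "\<And>e. e \<in> edges_of light \<Longrightarrow> f e = 1/6"
  shows "6 * (\<Sum>e \<in> cut net S. f e) =
    (\<Sum>j<6. path_length d (wire j)) + (\<Sum>k<5. path_length d (cycle k))"
proof -
  have sym: "d i j = d j i" for i j
    by (auto simp: d_def)
  have "(\<Sum>e \<in> cut net S. f e) = (\<Sum>(i, j) \<leftarrow> heavy. d i j / 3) + (\<Sum>(i, j) \<leftarrow> light. d i j / 6)"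
    unfolding sum_cut_net map_append sum_list_append using f edges_ofI
    by (intro arg_cong2[where f = "(+)"] arg_cong[where f = sum_list] map_cong)
       (fastforce simp: d_def)+
  then show ?thesis
    \<comment> \<open>The cycles traverse these edges against the order used in the edge
      lists.\<close>
    using sym[of 4 2] sym[of 2 1] sym[of 8 6] sym[of 6 5] sym[of 12 10] sym[of 10 9]
      sym[of 16 14] sym[of 14 13] sym[of 20 18] sym[of 18 17]
    by (simp add: edge_list_defs wire_def cycle_def lessThan_nat_numeral lessThan_Suc
        del: add_2_eq_Suc')
qed

lemma path_length_append:
  "path_length d (p @ i # q) = path_length d (p @ [i]) + path_length d (i # q)"
  by (induction p rule: induct_list012) (auto simp: neq_Nil_conv)

text \<open>Split \<open>p\<close> at \<open>i\<close> and apply the triangle inequality to both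
  halves. A wire with both ends on one side of a cut and a vertex on the other therefore crosses it
  at least twice.\<close>

lemma path_length_ge_via:
  assumes tri: "\<And>i j k. d i k \<le> d i j + d j k" and refl: "\<And>i. d i i = 0"
    and "i \<in> set p"
  shows "path_length d p \<ge> d (hd p) i + d i (last p)"
proof -
  obtain q s where p: "p = q @ i # s"
    using \<open>i \<in> set p\<close> by (meson split_list)
  have "d (hd p) i \<le> path_length d (q @ [i])" "d i (last p) \<le> path_length d (i # s)"
    using path_length_ge[of d, OF tri refl, of "q @ [i]"]
      path_length_ge[of d, OF tri refl, of "i # s"]
    by (cases q; simp add: p)+
  then show ?thesis
    using path_length_append[of d q i s] by (simp add: p)
qed

lemma wire_ends: "hd (wire j) = 0" "last (wire j) = 21"
  by (simp_all add: wire_def)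

lemma cut_net_ge:
  assumes f: "\<And>e. e \<in> edges_of heavy \<Longrightarrow> f e = 1/3" "\<And>e. e \<in> edges_of light \<Longrightarrow> f e = 1/6"
  shows "(0 \<in> S) \<noteq> (21 \<in> S) \<Longrightarrow> (\<Sum>e \<in> cut net S. f e) \<ge> (1::real)"
    and "v < 21 \<Longrightarrow> (v \<in> S) \<noteq> (21 \<in> S) \<Longrightarrow> (\<Sum>e \<in> cut net S. f e) \<ge> 2/3"
proof -
  define d where "d = (\<lambda>i j. of_bool ((i \<in> S) \<noteq> (j \<in> S)) :: real)"
  have tri: "d i k \<le> d i j + d j k" for i j k
    by (simp add: d_def)
  have refl: "d i i = 0" and sym: "d i j = d j i" for i j
    by (auto simp: d_def)
  have total: "6 * (\<Sum>e \<in> cut net S. f e) =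
      (\<Sum>j<6. path_length d (wire j)) + (\<Sum>k<5. path_length d (cycle k))"
    unfolding d_def by (rule six_cut_net_eq_wires[OF f])
  have wire_ge: "path_length d (wire j) \<ge> d 0 i + d i 21" if "i \<in> set (wire j)" for i j
    using path_length_ge_via[of d, OF tri refl that] by (simp add: wire_ends)
  \<comment> \<open>A cycle edge and the three remaining edges form two paths between the same
    endpoints.\<close>
  have cycle_ge: "path_length d (cycle k) \<ge> 2 * d i j"
    if "(i, j) = (4*k+1, 4*k+2) \<or> (i, j) = (4*k+3, 4*k+4)" for i j k
    using that path_length_ge[of d, OF tri refl, of "[4*k+1, 4*k+3, 4*k+4, 4*k+2]"]
      path_length_ge[of d, OF tri refl, of "[4*k+4, 4*k+2, 4*k+1, 4*k+3]"]
    by (auto simp: cycle_def sym)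
  have nonneg: "path_length d p \<ge> 0" for p
    by (induction p rule: induct_list012) (auto simp: d_def)
  show sep: "(\<Sum>e \<in> cut net S. f e) \<ge> 1" if "(0 \<in> S) \<noteq> (21 \<in> S)"
  proof -
    have "path_length d (wire j) \<ge> 1" for j
      using wire_ge[of 0 j] that by (simp add: d_def wire_def)
    then have "(\<Sum>j<6. path_length d (wire j)) \<ge> (\<Sum>j<(6::nat). 1)"
      by (intro sum_mono)
    moreover have "(\<Sum>k<5. path_length d (cycle k)) \<ge> 0"
      by (intro sum_nonneg nonneg)
    ultimately show ?thesis using total by simp
  qed
  show "(\<Sum>e \<in> cut net S. f e) \<ge> 2/3" if v: "v < 21" "(v \<in> S) \<noteq> (21 \<in> S)"
  proof (cases "(0 \<in> S) = (21 \<in> S)")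
    case True
    define k where "k = (v - 1) div 4"
    have "v \<noteq> 0" using v True by metis
    then have k: "k < 5" and "v \<in> {4*k+1, 4*k+2, 4*k+3, 4*k+4}"
      using v(1) unfolding k_def by auto
    have d21: "d i 21 = d 0 i" for i
      using True by (auto simp: d_def)
    obtain i j where ij: "(i, j) = (4*k+1, 4*k+2) \<or> (i, j) = (4*k+3, 4*k+4)" "v = i \<or> v = j"
      using \<open>v \<in> _\<close> by blast
    have "i \<in> set (wire k)" "j \<in> set (wire (Suc k))"
      using ij(1) k by (auto simp: wire_def)
    then have "path_length d (wire k) \<ge> 2 * d 0 i" "path_length d (wire (Suc k)) \<ge> 2 * d 0 j"
      using wire_ge d21 by fastforce+
    moreover have "path_length d (cycle k) \<ge> 2 * d i j"
      by (rule cycle_ge[OF ij(1)])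
    moreover have "d 0 i + d i j \<ge> d 0 j" "d 0 j + d i j \<ge> d 0 i"
      using tri[of 0 j i] tri[of 0 i j] sym[of i j] by simp_all
    moreover have "d 0 v = 1" using v True by (auto simp: d_def)
    \<comment> \<open>The left side is at least twice \<open>d 0 i + d 0 j + d i j\<close>. The
      distance from 0 to \<open>v\<close> is 1, and the other two distances add up to at least
      that.\<close>
    ultimately have *: "path_length d (wire k) + path_length d (wire (Suc k)) +
        path_length d (cycle k) \<ge> 4"
      using ij(2) by auto
    have "(\<Sum>j<6. path_length d (wire j)) \<ge> (\<Sum>j\<in>{k, Suc k}. path_length d (wire j))"
      using k by (intro sum_mono2 nonneg) auto
    moreover have "(\<Sum>j<5. path_length d (cycle j)) \<ge> (\<Sum>j\<in>{k}. path_length d (cycle j))"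
      using k by (intro sum_mono2 nonneg) auto
    ultimately show ?thesis using * total by simp
  qed (use sep in simp)
qed

section \<open>Explicit values of the relevant cuts\<close>

lemma sum_cut_singles:
  fixes f :: "nat set \<Rightarrow> real"
  assumes "k < 5"
  shows "(\<Sum>e \<in> cut net {4*k+1}. f e) = f {4*k, 4*k+1} + f {4*k+1, 4*k+3} + f {4*k+1, 4*k+2}"
    and "(\<Sum>e \<in> cut net {4*k+2}. f e) = f {0, 4*k+2} + f {4*k+2, 4*k+4} + f {4*k+1, 4*k+2}"
    and "(\<Sum>e \<in> cut net {4*k+3}. f e) = f {4*k+3, 21} + f {4*k+1, 4*k+3} + f {4*k+3, 4*k+4}"
    and "(\<Sum>e \<in> cut net {4*k+4}. f e) = f {4*k+4, 4*k+5} + f {4*k+2, 4*k+4} + f {4*k+3, 4*k+4}"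
  using assms by (elim less_5E; hypsubst; simp add: sum_cut_net edge_list_defs)+

text \<open>Like the singletons, these sets have cut value 2/3 at \<open>x0\<close>, so each gives a
  tight constraint for every vertex it contains.\<close>

lemma sum_cut_blocks:
  fixes f :: "nat set \<Rightarrow> real"
  assumes "k < 5"
  shows "(\<Sum>e \<in> cut net {4*k+1, 4*k+3}. f e) =
      f {4*k, 4*k+1} + f {4*k+1, 4*k+2} + f {4*k+3, 21} + f {4*k+3, 4*k+4}"
    and "(\<Sum>e \<in> cut net {4*k+2, 4*k+4}. f e) =
      f {0, 4*k+2} + f {4*k+1, 4*k+2} + f {4*k+4, 4*k+5} + f {4*k+3, 4*k+4}"
    and "(\<Sum>e \<in> cut net {4*k+1, 4*k+2, 4*k+3, 4*k+4}. f e) =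
      f {4*k, 4*k+1} + f {0, 4*k+2} + f {4*k+3, 21} + f {4*k+4, 4*k+5}"
  using assms by (elim less_5E; hypsubst; simp add: sum_cut_net edge_list_defs)+

text \<open>Adding block \<open>k\<close> to \<open>{..4 * k}\<close> removes the two edges entering
  the block from the cut and inserts the two edges leaving it.\<close>

lemma sum_cut_prefix:
  fixes f :: "nat set \<Rightarrow> real"
  shows "(\<Sum>e \<in> cut net {..0}. f e) = f {0, 1} + f {0, 2} + f {0, 6} + f {0, 10} + f {0, 14} + f {0, 18}"
    and "k < 5 \<Longrightarrow>
      (\<Sum>e \<in> cut net {..4 * Suc k}. f e) + f {4*k, 4*k+1} + f {0, 4*k+2} =
      (\<Sum>e \<in> cut net {..4 * k}. f e) + f {4*k+3, 21} + f {4*k+4, 4*k+5}"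
  by (simp add: sum_cut_net edge_list_defs del: add_2_eq_Suc')
     (elim less_5E; hypsubst; simp add: sum_cut_net edge_list_defs)

lemma edges_of_heavyE:
  assumes "e \<in> edges_of heavy"
  obtains k where "k < 5" "e = {4*k+1, 4*k+3} \<or> e = {4*k+2, 4*k+4}"
  using assms by (auto simp: edges_of_def heavy_def)

text \<open>The last alternative repeats the fifth one for the next block, except that
  \<open>k = 4\<close> yields the edge \<open>{20, 21}\<close> into the root.\<close>

lemma edges_of_lightE:
  assumes "e \<in> edges_of light"
  obtains k where "k < 5" "e = {0, 4*k+2} \<or> e = {4*k+1, 4*k+2} \<or> e = {4*k+3, 4*k+4} \<or>
    e = {4*k+3, 21} \<or> e = {4*k, 4*k+1} \<or> e = {4*k+4, 4*k+5}"
proof -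
  from assms consider k where "k < 5" "e = {0, 4*k+2} \<or> e = {4*k+1, 4*k+2} \<or>
      e = {4*k+3, 4*k+4} \<or> e = {4*k+3, 21} \<or> e = {4*k, 4*k+1}" | "e = {20, 21}"
    by (auto simp: edges_of_def light_def)
  then show thesis
  proof cases
    case (1 k)
    then show thesis using that[of k] by blast
  next
    case 2
    then show thesis using that[of 4] by simp
  qed
qed

section \<open>The point and its feasibility\<close>

definition x0 :: "nat set \<Rightarrow>\<^sub>0 real" where
  "x0 = Abs_poly_mapping (\<lambda>e. if e \<in> edges_of heavy then 1/3 else if e \<in> edges_of light then 1/6 else 0)"

text \<open>Block vertices need 1/3 because their cuts can be as small as 2/3; vertex 0 gets 0
  because every cut separating it from the root has value at least 1.\<close>

definition z0 :: "nat \<Rightarrow>\<^sub>0 real" where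
  "z0 = Abs_poly_mapping (\<lambda>v. if v \<in> {1..20} then 1/3 else 0)"

lemma lookup_x0:
  "Poly_Mapping.lookup x0 e = (if e \<in> edges_of heavy then 1/3 else if e \<in> edges_of light then 1/6 else 0)"
  unfolding x0_def
  by (subst lookup_Abs_poly_mapping) (auto intro: finite_subset[of _ "edges_of heavy \<union> edges_of light"])

lemma lookup_z0: "Poly_Mapping.lookup z0 v = (if v \<in> {1..20} then 1/3 else 0)"
  unfolding z0_def
  by (subst lookup_Abs_poly_mapping) (auto intro: finite_subset[of _ "{1..20}"])

lemma x0_heavy: "e \<in> edges_of heavy \<Longrightarrow> Poly_Mapping.lookup x0 e = 1/3"
  by (simp add: lookup_x0)

lemma x0_light: "e \<in> edges_of light \<Longrightarrow> Poly_Mapping.lookup x0 e = 1/6"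
  using heavy_light_disjoint by (auto simp: lookup_x0)

lemma x0_block:
  assumes "k < 5"
  shows "Poly_Mapping.lookup x0 {4*k+1, 4*k+3} = 1/3" "Poly_Mapping.lookup x0 {4*k+2, 4*k+4} = 1/3"
    and "Poly_Mapping.lookup x0 {0, 4*k+2} = 1/6" "Poly_Mapping.lookup x0 {4*k+1, 4*k+2} = 1/6"
    and "Poly_Mapping.lookup x0 {4*k+3, 4*k+4} = 1/6" "Poly_Mapping.lookup x0 {4*k+3, 21} = 1/6"
    and "Poly_Mapping.lookup x0 {4*k, 4*k+1} = 1/6" "Poly_Mapping.lookup x0 {4*k+4, 4*k+5} = 1/6"
  by (intro x0_heavy x0_light edges_ofI;
      use assms in \<open>elim less_5E; hypsubst; simp add: edge_list_defs\<close>)+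

text \<open>Six edges of weight 1/6 leave vertex 0, and each added block swaps two edges of weight
  1/6 for two others.\<close>

lemma x0_prefix: "k < 6 \<Longrightarrow> (\<Sum>e \<in> cut net {..4 * k}. Poly_Mapping.lookup x0 e) = 1"
proof (induction k)
  case 0
  then show ?case
    using sum_cut_prefix(1)[of "Poly_Mapping.lookup x0"] x0_block(3)[of 0] x0_block(3)[of 1]
      x0_block(3)[of 2] x0_block(3)[of 3] x0_block(3)[of 4] x0_block(7)[of 0]
    by (simp add: numeral_2_eq_2)
next
  case (Suc k)
  then have k: "k < 5" by auto
  then show ?case
    using Suc.IH sum_cut_prefix(2)[OF k, of "Poly_Mapping.lookup x0"] x0_block[OF k] by auto
qed

lemma x0_z0_feasible: "(x0, z0) \<in> pcst_lp_feasible {..21} net {..21} 21"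
proof -
  have "Poly_Mapping.keys x0 \<subseteq> net"
    by (auto simp: in_keys_iff lookup_x0 net_def edges_of_append split: if_splits)
  moreover have "Poly_Mapping.keys z0 \<subseteq> {..21} - {21}"
    by (auto simp: in_keys_iff lookup_z0 split: if_splits)
  moreover have "(\<Sum>e \<in> cut net S. Poly_Mapping.lookup x0 e) + Poly_Mapping.lookup z0 v \<ge> 1"
    if "v \<in> {..21} - {21}" "(v \<in> S) \<noteq> (21 \<in> S)" for v S
    using that cut_net_ge[where f = "Poly_Mapping.lookup x0" and S = S, OF x0_heavy x0_light]
    by (cases "v = 0") (fastforce simp: lookup_z0)+
  ultimately show ?thesis
    by (simp add: pcst_lp_feasible_def lookup_x0 lookup_z0)
qed

section \<open>Extremality of the point\<close>

lemma x0_z0_extreme: "(x0, z0) extreme_point_of pcst_lp_feasible {..21} net {..21} 21"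
proof (rule extreme_point_pcst_lpI[OF x0_z0_feasible])
  fix x z
  assume feas: "(x, z) \<in> pcst_lp_feasible {..21} net {..21} (21::nat)"
    and tight: "\<And>v S. v \<in> {..21} - {21} \<Longrightarrow> S \<subseteq> {..21} \<Longrightarrow> (v \<in> S) \<noteq> (21 \<in> S) \<Longrightarrow>
         (\<Sum>e \<in> cut net S. Poly_Mapping.lookup x0 e) + Poly_Mapping.lookup z0 v = 1 \<Longrightarrow>
         (\<Sum>e \<in> cut net S. Poly_Mapping.lookup x e) + Poly_Mapping.lookup z v = 1"
    and zero: "\<And>v. v \<in> {..21} - {21} \<Longrightarrow> Poly_Mapping.lookup z0 v = 0 \<Longrightarrow> Poly_Mapping.lookup z v = 0"
  define f where "f = Poly_Mapping.lookup x"
  define g where "g = Poly_Mapping.lookup z"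
  \<comment> \<open>Since \<open>z\<close> vanishes at vertex 0, the tight cuts for that vertex
    constrain \<open>x\<close> alone.\<close>
  have prefix: "(\<Sum>e \<in> cut net {..4 * k}. f e) = 1" if "k < 6" for k
    using tight[of 0 "{..4 * k}"] zero[of 0] x0_prefix[OF that] that
    by (auto simp: lookup_z0 f_def)
  have block: "f {0, 4*k+2} = f {4*k, 4*k+1}" "f {4*k+3, 21} = f {4*k, 4*k+1}"
      "f {4*k+4, 4*k+5} = f {4*k, 4*k+1}" "f {4*k+1, 4*k+2} = f {4*k, 4*k+1}"
      "f {4*k+3, 4*k+4} = f {4*k, 4*k+1}" "f {4*k+1, 4*k+3} = 2 * f {4*k, 4*k+1}"
      "f {4*k+2, 4*k+4} = 2 * f {4*k, 4*k+1}"
      "g (4*k+1) = 1 - 4 * f {4*k, 4*k+1}" "g (4*k+2) = 1 - 4 * f {4*k, 4*k+1}"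
      "g (4*k+3) = 1 - 4 * f {4*k, 4*k+1}" "g (4*k+4) = 1 - 4 * f {4*k, 4*k+1}"
    if k: "k < 5" for k
  proof -
    note x0_simps = sum_cut_singles[OF k] sum_cut_blocks[OF k] x0_block[OF k]
    have t: "(\<Sum>e \<in> cut net S. f e) + g v = 1"
      if "v \<in> S" "S \<subseteq> {4*k+1, 4*k+2, 4*k+3, 4*k+4}"
        "(\<Sum>e \<in> cut net S. Poly_Mapping.lookup x0 e) = 2/3" for v S
    proof -
      have "v \<in> {1..20}" "21 \<notin> S" "S \<subseteq> {..21}"
        using that k by auto
      then show ?thesis
        using tight[of v S] that by (simp add: f_def g_def lookup_z0)
    qed
    have "f {4*k, 4*k+1} + f {0, 4*k+2} = f {4*k+3, 21} + f {4*k+4, 4*k+5}"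
      using sum_cut_prefix(2)[OF k, of f] prefix[of k] prefix[of "Suc k"] k by auto
    then have eqs:
      "f {4*k, 4*k+1} + f {4*k+1, 4*k+3} + f {4*k+1, 4*k+2} + g (4*k+1) = 1"
      "f {0, 4*k+2} + f {4*k+2, 4*k+4} + f {4*k+1, 4*k+2} + g (4*k+2) = 1"
      "f {4*k+3, 21} + f {4*k+1, 4*k+3} + f {4*k+3, 4*k+4} + g (4*k+3) = 1"
      "f {4*k+4, 4*k+5} + f {4*k+2, 4*k+4} + f {4*k+3, 4*k+4} + g (4*k+4) = 1"
      "f {4*k, 4*k+1} + f {4*k+1, 4*k+2} + f {4*k+3, 21} + f {4*k+3, 4*k+4} + g (4*k+1) = 1"
      "f {4*k, 4*k+1} + f {4*k+1, 4*k+2} + f {4*k+3, 21} + f {4*k+3, 4*k+4} + g (4*k+3) = 1"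
      "f {0, 4*k+2} + f {4*k+1, 4*k+2} + f {4*k+4, 4*k+5} + f {4*k+3, 4*k+4} + g (4*k+2) = 1"
      "f {0, 4*k+2} + f {4*k+1, 4*k+2} + f {4*k+4, 4*k+5} + f {4*k+3, 4*k+4} + g (4*k+4) = 1"
      "f {4*k, 4*k+1} + f {0, 4*k+2} + f {4*k+3, 21} + f {4*k+4, 4*k+5} + g (4*k+1) = 1"
      "f {4*k, 4*k+1} + f {0, 4*k+2} + f {4*k+3, 21} + f {4*k+4, 4*k+5} + g (4*k+2) = 1"
      "f {4*k, 4*k+1} + f {0, 4*k+2} = f {4*k+3, 21} + f {4*k+4, 4*k+5}"
      using t[of "4*k+1" "{4*k+1}", unfolded x0_simps]
        t[of "4*k+2" "{4*k+2}", unfolded x0_simps]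
        t[of "4*k+3" "{4*k+3}", unfolded x0_simps]
        t[of "4*k+4" "{4*k+4}", unfolded x0_simps]
        t[of "4*k+1" "{4*k+1, 4*k+3}", unfolded x0_simps]
        t[of "4*k+3" "{4*k+1, 4*k+3}", unfolded x0_simps]
        t[of "4*k+2" "{4*k+2, 4*k+4}", unfolded x0_simps]
        t[of "4*k+4" "{4*k+2, 4*k+4}", unfolded x0_simps]
        t[of "4*k+1" "{4*k+1, 4*k+2, 4*k+3, 4*k+4}", unfolded x0_simps]
        t[of "4*k+2" "{4*k+1, 4*k+2, 4*k+3, 4*k+4}", unfolded x0_simps]
      by simp_all
    \<comment> \<open>Different vertices sharing a tight cut force \<open>g\<close> to be constant
      on the block. Comparing the two halves, and adding the balance of entering and leaving weight,
      makes the boundary edges equal in pairs. The singleton cuts then make all four equal and also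
      equate the two light cycle edges. The whole block and a half fix these at the same value, and
      the singletons give the heavy edges and \<open>g\<close>.\<close>
    show "f {0, 4*k+2} = f {4*k, 4*k+1}" "f {4*k+3, 21} = f {4*k, 4*k+1}"
      "f {4*k+4, 4*k+5} = f {4*k, 4*k+1}" "f {4*k+1, 4*k+2} = f {4*k, 4*k+1}"
      "f {4*k+3, 4*k+4} = f {4*k, 4*k+1}" "f {4*k+1, 4*k+3} = 2 * f {4*k, 4*k+1}"
      "f {4*k+2, 4*k+4} = 2 * f {4*k, 4*k+1}"
      "g (4*k+1) = 1 - 4 * f {4*k, 4*k+1}" "g (4*k+2) = 1 - 4 * f {4*k, 4*k+1}"
      "g (4*k+3) = 1 - 4 * f {4*k, 4*k+1}" "g (4*k+4) = 1 - 4 * f {4*k, 4*k+1}"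
      using eqs by linarith+
  qed
  \<comment> \<open>The edge \<open>{4*k+4, 4*k+5}\<close> leaving block \<open>k\<close> is the one
    entering block \<open>k + 1\<close>, so the free parameter is shared by all blocks.\<close>
  have chain: "f {4*k, 4*k+1} = f {0, 1}" if "k < 5" for k
    using that
  proof (induction k)
    case (Suc k)
    then have "k < 5" by auto
    then show ?case using Suc.IH block(3)[of k] by (simp add: algebra_simps)
  qed simp
  \<comment> \<open>The six edges at vertex 0 have equal values, and the cut \<open>{..0}\<close>
    normalizes their sum to 1.\<close>
  have "f {0, 1} = 1/6"
    using prefix[of 0] sum_cut_prefix(1)[of f] block(1)[of 0] block(1)[of 1] block(1)[of 2]
      block(1)[of 3] block(1)[of 4] chain[of 1] chain[of 2] chain[of 3] chain[of 4]
    by (simp add: numeral_2_eq_2)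
  then have in1: "f {4*k, 4*k+1} = 1/6" if "k < 5" for k
    using chain[OF that] by simp
  have "f e = Poly_Mapping.lookup x0 e" for e
  proof -
    have "f e = 1/3" if "e \<in> edges_of heavy"
      using that block(6,7) in1 by (elim edges_of_heavyE) fastforce
    moreover have "f e = 1/6" if "e \<in> edges_of light"
      using that block(1-5) in1 by (elim edges_of_lightE) metis
    moreover have "f e = 0" if "e \<notin> net"
      using that pcst_lp_feasibleD(1)[OF feas] by (auto simp: f_def in_keys_iff)
    ultimately show ?thesis
      using x0_heavy[of e] x0_light[of e] by (auto simp: lookup_x0 net_def edges_of_append)
  qed
  moreover have "g v = Poly_Mapping.lookup z0 v" for v
  proof -
    consider "v = 0" | "v \<in> {1..20}" | "v \<ge> 21" by fastforce
    then show ?thesis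
    proof cases
      case 1
      then show ?thesis using zero[of 0] by (simp add: g_def lookup_z0)
    next
      case 2
      define k where "k = (v - 1) div 4"
      have k: "k < 5" and "v \<in> {4*k+1, 4*k+2, 4*k+3, 4*k+4}"
        using 2 unfolding k_def by auto
      then have "g v = 1/3"
        using block(8-11)[OF k] in1[OF k] by auto
      with 2 show ?thesis by (simp add: lookup_z0)
    next
      case 3
      then show ?thesis
        using pcst_lp_feasibleD(2)[OF feas] by (auto simp: g_def lookup_z0 in_keys_iff)
    qed
  qed
  ultimately show "x = x0 \<and> z = z0"
    by (simp add: poly_mapping_eqI f_def g_def)
qed

theorem theorem2:
  shows "\<exists>(V :: nat set) E c R \<pi> r x z.
    pcst_instance V E c R \<pi> r \<and> R \<noteq> {r} \<and>
    (x, z) extreme_point_of pcst_lp_feasible V E R r \<and>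
    (\<forall>e \<in> E. Poly_Mapping.lookup x e > 0) \<and>
    (\<forall>e \<in> E. Poly_Mapping.lookup x e \<le> 1 / 3) \<and>
    (\<forall>v \<in> R - {r}. Poly_Mapping.lookup z v \<le> 1 / 3)"
proof (intro exI conjI)
  \<comment> \<open>The polyhedron is independent of costs and penalties, so both are set to
    zero.\<close>
  show "pcst_instance {..21} net (\<lambda>_. 0) {..21} (\<lambda>_. 0) (21::nat)"
  proof
    fix e assume "e \<in> net"
    then obtain i j where "e = {i, j}" "i < j" "j \<le> 21"
      using heavy_light(2) unfolding net_def edges_of_def by fastforce
    then show "e \<subseteq> {..21} \<and> card e = 2"
      by auto
  qed auto
  show "{..21} \<noteq> {21::nat}"
    by (metis atMost_iff singletonD zero_le zero_neq_numeral)
  show "(x0, z0) extreme_point_of pcst_lp_feasible {..21} net {..21} 21"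
    by (rule x0_z0_extreme)
qed (auto simp: lookup_x0 lookup_z0 net_def edges_of_append)

end
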